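(* Let $\omega,\hbar$ be positive real numbers, let $\xi=\xi_1\mathbf{e_1}+\xi_2\mathbf{e_2}$ with $\xi_1,\xi_2$ real and $>0$, let $M$ be a free $\mathbb{T}$-module with basis $\{|\phi_l\rangle\}_{l=0,1,2,\dots}$ (elements of $M$ being finite linear combinations), and let $H:M\to M$ be the $\mathbb{T}$-linear operator with $H|\phi_l\rangle=(l+\frac12)\hbar\omega\xi|\phi_l\rangle$ for all $l\ge0$. For $k=1,2$ write $|\phi_l\rangle_{\mathbf{k}}=\mathbf{e_k}|\phi_l\rangle$. Let $|\phi\rangle\in M$ be an eigenket of $H$ with eigenvalue $\lambda$, and write $\lambda_{\mathbf{k}}=\mathbf{e_k}\lambda$. Then $|\phi\rangle$ has the form $$|\phi\rangle=w_{l\mathbf{1}}|\phi_l\rangle_{\mathbf{1}}+w_{l'\mathbf{2}}|\phi_{l'}\rangle_{\mathbf{2}}$$ for some integers $l,l'\ge0$ and some coefficients $w_{l\mathbf{1}}\in\mathbf{e_1}\mathbb{T}$, $w_{l'\mathbf{2}}\in\mathbf{e_2}\mathbb{T}$, with one of the coefficients vanishing if the corresponding $\lambda_{\mathbf{k}}$ vanishes; if both $\lambda_{\mathbf{k}}$ vanish, there is no eigenket. This form represents the most general eigenket of $H$. Its associated eigenvalue $\lambda$ is $$\lambda=\hbar\omega\left\{\left(l+\tfrac12\right)\xi_1\mathbf{e_1}+\left(l'+\tfrac12\right)\xi_2\mathbf{e_2}\right\}.$$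
   Context: Bicomplex numbers: $\mathbb{T}=\{w_e+w_{1}\mathrm{i}_1+w_{2}\mathrm{i}_2+w_j\mathrm{j} : w_e,w_1,w_2,w_j\in\mathbb{R}\}$ is the commutative ring with $\mathrm{i}_1^2=\mathrm{i}_2^2=-1$, $\mathrm{j}^2=1$, $\mathrm{i}_1\mathrm{i}_2=\mathrm{j}$, $\mathrm{i}_1\mathrm{j}=-\mathrm{i}_2$, $\mathrm{i}_2\mathrm{j}=-\mathrm{i}_1$. Put $\mathbf{e_1}=(1+\mathrm{j})/2$, $\mathbf{e_2}=(1-\mathrm{j})/2$; these are idempotent, $\mathbf{e_1}+\mathbf{e_2}=1$, $\mathbf{e_1}\mathbf{e_2}=0$. Every $w\in\mathbb{T}$ is uniquely $w=z_1\mathbf{e_1}+z_2\mathbf{e_2}$ with $z_1,z_2\in\mathbb{C}(\mathrm{i}_1)=\{x+y\mathrm{i}_1:x,y\in\mathbb{R}\}$, and operations are componentwise. Elements of $M$ are called kets. An eigenket of $H$ with eigenvalue $\lambda\in\mathbb{T}$ is a nonzero ket $|\psi\rangle$ with $H|\psi\rangle=\lambda|\psi\rangle$.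
   Formalization: The eigenvalue formula is asserted for a given λ only in components whose coefficient is nonzero (fully if both are); unconditionally it fails, e.g. for e₂φ₀ with λ = ½ħωξ₂e₂. The formula value is still shown to be an eigenvalue of every nonzero ket of the form. *)

theory Defs
  imports Complex_Main
begin

(* Bicomplex w_e w_1 w_2 w_j stands for w_e + w_1 i1 + w_2 i2 + w_j j. *)
datatype bicomplex = Bicomplex (cf_e: real) (cf_i1: real) (cf_i2: real) (cf_j: real)

instantiation bicomplex :: comm_ring_1
begin

definition zero_bicomplex :: bicomplex where
  "0 = Bicomplex 0 0 0 0"

definition one_bicomplex :: bicomplex where
  "1 = Bicomplex 1 0 0 0"

definition uminus_bicomplex :: "bicomplex \<Rightarrow> bicomplex" where
  "- v = Bicomplex (- cf_e v) (- cf_i1 v) (- cf_i2 v) (- cf_j v)"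

definition plus_bicomplex :: "bicomplex \<Rightarrow> bicomplex \<Rightarrow> bicomplex" where
  "v + w = Bicomplex (cf_e v + cf_e w) (cf_i1 v + cf_i1 w) (cf_i2 v + cf_i2 w) (cf_j v + cf_j w)"

definition minus_bicomplex :: "bicomplex \<Rightarrow> bicomplex \<Rightarrow> bicomplex" where
  "v - w = Bicomplex (cf_e v - cf_e w) (cf_i1 v - cf_i1 w) (cf_i2 v - cf_i2 w) (cf_j v - cf_j w)"

(* The bilinear extension of the multiplication table bc_mult_table below. *)
definition times_bicomplex :: "bicomplex \<Rightarrow> bicomplex \<Rightarrow> bicomplex" where
  "v * w = Bicomplex
     (cf_e v * cf_e w - cf_i1 v * cf_i1 w - cf_i2 v * cf_i2 w + cf_j v * cf_j w)
     (cf_e v * cf_i1 w + cf_i1 v * cf_e w - cf_i2 v * cf_j w - cf_j v * cf_i2 w)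
     (cf_e v * cf_i2 w + cf_i2 v * cf_e w - cf_i1 v * cf_j w - cf_j v * cf_i1 w)
     (cf_e v * cf_j w + cf_j v * cf_e w + cf_i1 v * cf_i2 w + cf_i2 v * cf_i1 w)"

instance
  by standard
    (simp_all add: zero_bicomplex_def one_bicomplex_def uminus_bicomplex_def
      plus_bicomplex_def minus_bicomplex_def times_bicomplex_def algebra_simps bicomplex.expand)

end

instantiation bicomplex :: real_algebra_1
begin

definition scaleR_bicomplex :: "real \<Rightarrow> bicomplex \<Rightarrow> bicomplex" where
  "r *\<^sub>R w = Bicomplex (r * cf_e w) (r * cf_i1 w) (r * cf_i2 w) (r * cf_j w)"

instance
  by standard
    (simp_all add: scaleR_bicomplex_def zero_bicomplex_def one_bicomplex_def
      plus_bicomplex_def times_bicomplex_def algebra_simps bicomplex.expand)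

end

definition bc_i1 :: bicomplex where "bc_i1 = Bicomplex 0 1 0 0"
definition bc_i2 :: bicomplex where "bc_i2 = Bicomplex 0 0 1 0"
definition bc_j :: bicomplex where "bc_j = Bicomplex 0 0 0 1"

lemma bc_mult_table:
  "bc_i1 * bc_i1 = -1" "bc_i2 * bc_i2 = -1" "bc_j * bc_j = 1"
  "bc_i1 * bc_i2 = bc_j" "bc_i1 * bc_j = - bc_i2" "bc_i2 * bc_j = - bc_i1"
  by (simp_all add: bc_i1_def bc_i2_def bc_j_def times_bicomplex_def
      one_bicomplex_def uminus_bicomplex_def)

definition bc_e1 :: bicomplex where "bc_e1 = (1/2) *\<^sub>R (1 + bc_j)"
definition bc_e2 :: bicomplex where "bc_e2 = (1/2) *\<^sub>R (1 - bc_j)"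

lemma bc_idempotents:
  "bc_e1 * bc_e1 = bc_e1" "bc_e2 * bc_e2 = bc_e2" "bc_e1 * bc_e2 = 0" "bc_e1 + bc_e2 = 1"
  by (simp_all add: bc_e1_def bc_e2_def bc_j_def scaleR_bicomplex_def plus_bicomplex_def
      minus_bicomplex_def times_bicomplex_def one_bicomplex_def zero_bicomplex_def)

(* Injectivity makes linear independence of the range linear independence of the family. *)
definition indexed_basis ::
    "(bicomplex \<Rightarrow> 'm \<Rightarrow> 'm::ab_group_add) \<Rightarrow> (nat \<Rightarrow> 'm) \<Rightarrow> bool" where
  "indexed_basis scale b \<longleftrightarrow>
     inj b \<and> \<not> module.dependent scale (range b) \<and> module.span scale (range b) = UNIV"

definition eigenket ::
    "(bicomplex \<Rightarrow> 'm \<Rightarrow> 'm::ab_group_add) \<Rightarrow> ('m \<Rightarrow> 'm) \<Rightarrow> 'm \<Rightarrow> bicomplex \<Rightarrow> bool" where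
  "eigenket scale H \<psi> \<mu> \<longleftrightarrow> \<psi> \<noteq> 0 \<and> H \<psi> = scale \<mu> \<psi>"

definition osc_ket ::
    "(bicomplex \<Rightarrow> 'm \<Rightarrow> 'm::ab_group_add) \<Rightarrow> (nat \<Rightarrow> 'm) \<Rightarrow>
     nat \<Rightarrow> nat \<Rightarrow> bicomplex \<Rightarrow> bicomplex \<Rightarrow> 'm" where
  "osc_ket scale b l l' w1 w2 =
     scale w1 (scale bc_e1 (b l)) + scale w2 (scale bc_e2 (b l'))"

definition osc_eigenvalue :: "real \<Rightarrow> real \<Rightarrow> real \<Rightarrow> real \<Rightarrow> nat \<Rightarrow> nat \<Rightarrow> bicomplex" where
  "osc_eigenvalue hbar \<omega> \<xi>1 \<xi>2 l l' = of_real (hbar * \<omega>) *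
     (of_real ((real l + 1/2) * \<xi>1) * bc_e1 + of_real ((real l' + 1/2) * \<xi>2) * bc_e2)"

end

theory Submission
  imports Defs
begin

text \<open>The idempotent components \<open>z\<^sub>1, z\<^sub>2\<close> of a bicomplex number are ring
  homomorphisms to the complex numbers, and in the field of complex numbers the coordinatewise
  eigenvalue equation \<open>(\<mu> - E l) * c l = 0\<close> leaves at most one nonzero coordinate, because
  the levels \<open>E l\<close> are distinct. Hence each idempotent component of an eigenket is
  supported on a single basis ket, independently of the other component.\<close>

text \<open>On the \<open>bc_e1\<close> component j acts as 1, so i1 j = -i2 turns i2 into -i1; on
  the \<open>bc_e2\<close> component j acts as -1 and i2 becomes i1. The formulas of
  \<open>idem1\<close> and \<open>idem2\<close> result from these substitutions.\<close>

definition idem1 :: "bicomplex \<Rightarrow> complex" where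
  "idem1 w = Complex (cf_e w + cf_j w) (cf_i1 w - cf_i2 w)"

definition idem2 :: "bicomplex \<Rightarrow> complex" where
  "idem2 w = Complex (cf_e w - cf_j w) (cf_i1 w + cf_i2 w)"

lemmas bicomplex_defs = zero_bicomplex_def one_bicomplex_def plus_bicomplex_def
  times_bicomplex_def minus_bicomplex_def scaleR_bicomplex_def
  bc_j_def bc_e1_def bc_e2_def

lemma idem1_simps [simp]:
  "idem1 0 = 0" "idem1 1 = 1" "idem1 (v + w) = idem1 v + idem1 w" "idem1 (v * w) = idem1 v * idem1 w"
  "idem1 (of_real r) = of_real r" "idem1 bc_e1 = 1" "idem1 bc_e2 = 0"
  by (simp_all add: idem1_def bicomplex_defs of_real_def complex_eq_iff algebra_simps)

lemma idem2_simps [simp]: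
  "idem2 0 = 0" "idem2 1 = 1" "idem2 (v + w) = idem2 v + idem2 w" "idem2 (v * w) = idem2 v * idem2 w"
  "idem2 (of_real r) = of_real r" "idem2 bc_e1 = 0" "idem2 bc_e2 = 1"
  by (simp_all add: idem2_def bicomplex_defs of_real_def complex_eq_iff algebra_simps)

lemma idem_of_nat [simp]: "idem1 (of_nat n) = of_nat n" "idem2 (of_nat n) = of_nat n"
  by (induction n) simp_all

text \<open>Sums and differences of coefficients recover all four of them. This moves each equation
  from a ring with zero divisors to two equations over a field.\<close>

lemma bicomplex_eq_iff_idem: "v = w \<longleftrightarrow> idem1 v = idem1 w \<and> idem2 v = idem2 w"
  by (cases v; cases w) (auto simp: idem1_def idem2_def)

text \<open>If \<open>c\<close> is zero everywhere, any \<open>l\<close> serves. That case does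
  occur: one idempotent component of an eigenket may vanish.\<close>

lemma diagonal_eigenvector_support:
  fixes c E :: "nat \<Rightarrow> 'a::idom"
  assumes "inj E" and "\<And>l. E l * c l = \<mu> * c l"
  obtains l where "\<And>m. c m \<noteq> 0 \<Longrightarrow> m = l \<and> E m = \<mu>"
proof -
  have "c m \<noteq> 0 \<Longrightarrow> E m = \<mu>" for m
    using assms(2)[of m] by simp
  with \<open>inj E\<close> show thesis
    by (metis injD that)
qed

locale bicomplex_free_module = module scale
  for scale :: "bicomplex \<Rightarrow> 'm::ab_group_add \<Rightarrow> 'm" +
  fixes b :: "nat \<Rightarrow> 'm"
  assumes basis: "indexed_basis scale b"
begin

lemma inj_b: "inj b" and indep: "independent (range b)" and span_b: "span (range b) = UNIV"
  using basis by (simp_all add: indexed_basis_def)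

definition coord :: "nat \<Rightarrow> 'm \<Rightarrow> bicomplex" where
  "coord l \<phi> = representation (range b) \<phi> (b l)"

lemma coord_simps [simp]:
  "coord l 0 = 0"
  "coord l (\<phi> + \<psi>) = coord l \<phi> + coord l \<psi>"
  "coord l (scale w \<phi>) = w * coord l \<phi>"
  "coord l (b m) = (if m = l then 1 else 0)"
  using inj_b indep span_b
  by (auto simp: coord_def representation_zero representation_add representation_scale
      representation_basis inj_eq)

text \<open>\<open>representation\<close> is zero off the basis, so the coordinates fix it as a
  function, and summing it against the basis gives the ket back.\<close>

lemma coord_eqI:
  assumes "\<And>l. coord l \<phi> = coord l \<psi>"
  shows "\<phi> = \<psi>"
proof -
  have "representation (range b) \<phi> = representation (range b) \<psi>"
  proof
    fix v
    show "representation (range b) \<phi> v = representation (range b) \<psi> v"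
      using assms representation_ne_zero[of "range b" _ v] by (fastforce simp: coord_def)
  qed
  then show ?thesis
    using sum_nonzero_representation_eq[OF indep] span_b by (metis UNIV_I)
qed

lemma coord_diagonal_hom:
  assumes "module_hom scale scale H" and H_b: "\<And>l. H (b l) = scale (E l) (b l)"
  shows "coord l (H \<phi>) = E l * coord l \<phi>"
proof -
  interpret H: module_hom scale scale H by fact
  have "\<phi> \<in> span (range b)"
    by (simp add: span_b)
  then show ?thesis
    by (induction rule: span_induct_alt)
      (auto simp: H.zero H.add H.scale H_b algebra_simps)
qed

text \<open>Each summand carries its own idempotent, so \<open>idem1\<close> kills the second and
  \<open>idem2\<close> the first; the two indices therefore never interact, even when equal.\<close>

lemma idem_coord_osc_ket [simp]:
  "idem1 (coord m (osc_ket scale b l l' w1 w2)) = (if m = l then idem1 w1 else 0)"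
  "idem2 (coord m (osc_ket scale b l l' w1 w2)) = (if m = l' then idem2 w2 else 0)"
  by (auto simp: osc_ket_def)

end

theorem mainTheorem3:
  fixes \<omega> hbar \<xi>1 \<xi>2 :: real
    and \<xi> :: bicomplex
    and scale :: "bicomplex \<Rightarrow> 'm \<Rightarrow> 'm::ab_group_add"
    and b :: "nat \<Rightarrow> 'm"
    and H :: "'m \<Rightarrow> 'm"
  assumes "\<omega> > 0" and "hbar > 0" and "\<xi>1 > 0" and "\<xi>2 > 0"
    and "\<xi> = of_real \<xi>1 * bc_e1 + of_real \<xi>2 * bc_e2"
    and "module scale"
    and "indexed_basis scale b"
    and "module_hom scale scale H"
    and "\<And>l. H (b l) = scale (of_real ((real l + 1/2) * hbar * \<omega>) * \<xi>) (b l)"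
  shows
    "(\<forall>\<phi> \<mu>. eigenket scale H \<phi> \<mu> \<longrightarrow>
        (\<exists>l l'. \<exists>w1 \<in> range ((*) bc_e1). \<exists>w2 \<in> range ((*) bc_e2).
           \<phi> = osc_ket scale b l l' w1 w2 \<and>
           (bc_e1 * \<mu> = 0 \<longrightarrow> w1 = 0) \<and> (bc_e2 * \<mu> = 0 \<longrightarrow> w2 = 0)))
     \<and> (\<forall>\<mu>. bc_e1 * \<mu> = 0 \<and> bc_e2 * \<mu> = 0 \<longrightarrow> \<not> (\<exists>\<phi>. eigenket scale H \<phi> \<mu>))
     \<and> (\<forall>l l'. \<forall>w1 \<in> range ((*) bc_e1). \<forall>w2 \<in> range ((*) bc_e2).
          osc_ket scale b l l' w1 w2 \<noteq> 0 \<longrightarrow>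
            eigenket scale H (osc_ket scale b l l' w1 w2) (osc_eigenvalue hbar \<omega> \<xi>1 \<xi>2 l l') \<and>
            (\<forall>\<mu>. eigenket scale H (osc_ket scale b l l' w1 w2) \<mu> \<longrightarrow>
               (w1 \<noteq> 0 \<longrightarrow> bc_e1 * \<mu> = bc_e1 * osc_eigenvalue hbar \<omega> \<xi>1 \<xi>2 l l') \<and>
               (w2 \<noteq> 0 \<longrightarrow> bc_e2 * \<mu> = bc_e2 * osc_eigenvalue hbar \<omega> \<xi>1 \<xi>2 l l') \<and>
               (w1 \<noteq> 0 \<and> w2 \<noteq> 0 \<longrightarrow> \<mu> = osc_eigenvalue hbar \<omega> \<xi>1 \<xi>2 l l')))"
proof -
  interpret bicomplex_free_module scale b
    by (intro bicomplex_free_module.intro bicomplex_free_module_axioms.intro assms)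
  define E where "E l = of_real ((real l + 1/2) * hbar * \<omega>) * \<xi>" for l
  define E1 E2 where "E1 = idem1 \<circ> E" and "E2 = idem2 \<circ> E"
  have E1: "E1 l = of_real ((real l + 1/2) * hbar * \<omega> * \<xi>1)"
    and E2: "E2 l = of_real ((real l + 1/2) * hbar * \<omega> * \<xi>2)" for l
    by (simp_all add: E1_def E2_def E_def assms(5))
  \<comment> \<open>Positivity of the constants makes the levels strictly increasing in
    \<open>l\<close>, and the zero-point term 1/2 keeps even the level at \<open>l = 0\<close> away
    from 0.\<close>
  have inj: "inj E1" "inj E2" and nz: "E1 l \<noteq> 0" "E2 l \<noteq> 0" for l
    using assms(1-4) by (auto simp: inj_def E1 E2 simp del: of_real_mult of_real_add)
  have coord_H: "coord l (H \<phi>) = E l * coord l \<phi>" for l \<phi>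
    using coord_diagonal_hom[OF assms(8)] assms(9) by (simp add: E_def)
  have osc: "idem1 (osc_eigenvalue hbar \<omega> \<xi>1 \<xi>2 l l') = E1 l"
    "idem2 (osc_eigenvalue hbar \<omega> \<xi>1 \<xi>2 l l') = E2 l'" for l l'
    by (simp_all add: osc_eigenvalue_def E1 E2)
  have eq1: "E1 l * idem1 (coord l \<phi>) = idem1 \<mu> * idem1 (coord l \<phi>)"
    and eq2: "E2 l * idem2 (coord l \<phi>) = idem2 \<mu> * idem2 (coord l \<phi>)"
    if "eigenket scale H \<phi> \<mu>" for \<phi> \<mu> l
  proof -
    have "E l * coord l \<phi> = \<mu> * coord l \<phi>"
      using that coord_H by (metis eigenket_def coord_simps(3))
    then show "E1 l * idem1 (coord l \<phi>) = idem1 \<mu> * idem1 (coord l \<phi>)"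
      "E2 l * idem2 (coord l \<phi>) = idem2 \<mu> * idem2 (coord l \<phi>)"
      by (simp_all add: bicomplex_eq_iff_idem E1_def E2_def)
  qed
  have form: "\<exists>l l'. \<exists>w1 \<in> range ((*) bc_e1). \<exists>w2 \<in> range ((*) bc_e2).
           \<phi> = osc_ket scale b l l' w1 w2 \<and>
           (bc_e1 * \<mu> = 0 \<longrightarrow> w1 = 0) \<and> (bc_e2 * \<mu> = 0 \<longrightarrow> w2 = 0)"
    if eigen: "eigenket scale H \<phi> \<mu>" for \<phi> \<mu>
  proof -
    obtain l where l: "\<And>m. idem1 (coord m \<phi>) \<noteq> 0 \<Longrightarrow> m = l \<and> E1 m = idem1 \<mu>"
      using diagonal_eigenvector_support[OF inj(1) eq1[OF eigen]] by blast
    obtain l' where l': "\<And>m. idem2 (coord m \<phi>) \<noteq> 0 \<Longrightarrow> m = l' \<and> E2 m = idem2 \<mu>"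
      using diagonal_eigenvector_support[OF inj(2) eq2[OF eigen]] by blast
    let ?w1 = "bc_e1 * coord l \<phi>" and ?w2 = "bc_e2 * coord l' \<phi>"
    have "\<phi> = osc_ket scale b l l' ?w1 ?w2"
      using l l' by (intro coord_eqI) (auto simp: bicomplex_eq_iff_idem)
    \<comment> \<open>A nonzero component at \<open>l\<close> would force
      \<open>E1 l = idem1 \<mu>\<close>, which is 0 here, against \<open>nz\<close>.\<close>
    moreover have "bc_e1 * \<mu> = 0 \<longrightarrow> ?w1 = 0"
      using l[of l] nz(1)[of l]
      by (cases "idem1 (coord l \<phi>) = 0") (auto simp: bicomplex_eq_iff_idem)
    moreover have "bc_e2 * \<mu> = 0 \<longrightarrow> ?w2 = 0"
      using l'[of l'] nz(2)[of l']
      by (cases "idem2 (coord l' \<phi>) = 0") (auto simp: bicomplex_eq_iff_idem)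
    ultimately show ?thesis
      by blast
  qed
  have no_eigenket: "\<not> (\<exists>\<phi>. eigenket scale H \<phi> \<mu>)" if "bc_e1 * \<mu> = 0 \<and> bc_e2 * \<mu> = 0" for \<mu>
  proof
    assume "\<exists>\<phi>. eigenket scale H \<phi> \<mu>"
    then obtain \<phi> where \<phi>: "eigenket scale H \<phi> \<mu>" ..
    \<comment> \<open>Both coefficients in the form vanish.\<close>
    with form[OF \<phi>] that have "\<phi> = 0"
      by (auto simp: osc_ket_def)
    with \<phi> show False
      by (simp add: eigenket_def)
  qed
  have osc_eigenket:
    "eigenket scale H (osc_ket scale b l l' w1 w2) (osc_eigenvalue hbar \<omega> \<xi>1 \<xi>2 l l')"
    if "osc_ket scale b l l' w1 w2 \<noteq> 0" for l l' w1 w2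
  proof -
    have "H (osc_ket scale b l l' w1 w2) =
        scale (osc_eigenvalue hbar \<omega> \<xi>1 \<xi>2 l l') (osc_ket scale b l l' w1 w2)"
      \<comment> \<open>At each coordinate \<open>idem1\<close> is nonzero at most for index
        \<open>l\<close>, where the factor is \<open>E1 l\<close>; likewise \<open>idem2\<close>
        with \<open>l'\<close> and \<open>E2 l'\<close>.\<close>
      by (intro coord_eqI) (auto simp: bicomplex_eq_iff_idem coord_H osc E1_def E2_def)
    with that show ?thesis
      by (simp add: eigenket_def)
  qed
  have unique:
    "(w1 \<noteq> 0 \<longrightarrow> bc_e1 * \<mu> = bc_e1 * osc_eigenvalue hbar \<omega> \<xi>1 \<xi>2 l l') \<and>
     (w2 \<noteq> 0 \<longrightarrow> bc_e2 * \<mu> = bc_e2 * osc_eigenvalue hbar \<omega> \<xi>1 \<xi>2 l l') \<and>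
     (w1 \<noteq> 0 \<and> w2 \<noteq> 0 \<longrightarrow> \<mu> = osc_eigenvalue hbar \<omega> \<xi>1 \<xi>2 l l')"
    if "w1 \<in> range ((*) bc_e1)" "w2 \<in> range ((*) bc_e2)"
      "eigenket scale H (osc_ket scale b l l' w1 w2) \<mu>" for l l' w1 w2 \<mu>
    \<comment> \<open>An element of the ideal generated by \<open>bc_e1\<close> has zero
      \<open>idem2\<close>, so if \<open>w1\<close> is nonzero then \<open>idem1 w1\<close> is too
      and cancels from \<open>eq1\<close> at \<open>l\<close>. This fixes only the first component
      of \<mu>; the second comes in the same way from \<open>w2\<close>.\<close>
    using that(1,2) eq1[OF that(3), of l] eq2[OF that(3), of l']
    by (auto simp: bicomplex_eq_iff_idem osc)
  show ?thesis
    using form no_eigenket by (intro conjI allI ballI impI osc_eigenket unique) assumption+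
qed

end
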